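(* For any integers $r$ and $\chi$ with $2\leq \chi\leq r+1$, there exists a Cayley graph that is $r$-regular and has chromatic number $\chi$.
   Context: Graphs are simple and finite. For a finite group $\Gamma$ and a generating set $X$ of $\Gamma$ with $X=X^{-1}$ and $1_\Gamma\notin X$, the Cayley graph $Cay(\Gamma,X)$ has vertex set $\Gamma$, with $g,h$ adjacent iff $gx=h$ for some $x\in X$. *)

theory Defs
  imports "HOL-Algebra.Generated_Groups" "Graph_Theory.Pair_Digraph"
begin

text \<open>
  A finite simple graph is a \<^locale>\<open>pair_graph\<close>: finitely many vertices and a symmetric, loop-free
  set of arcs, each undirected edge being represented by its two opposite arcs.
\<close>

definition connection_set :: "('a, 'b) monoid_scheme \<Rightarrow> 'a set \<Rightarrow> bool" where
  "connection_set \<Gamma> X \<longleftrightarrow>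
     X \<subseteq> carrier \<Gamma> \<and> generate \<Gamma> X = carrier \<Gamma> \<and> m_inv \<Gamma> ` X = X \<and> \<one>\<^bsub>\<Gamma>\<^esub> \<notin> X"

definition cayley_graph :: "('a, 'b) monoid_scheme \<Rightarrow> 'a set \<Rightarrow> 'a pair_pre_digraph" where
  "cayley_graph \<Gamma> X =
     \<lparr> pverts = carrier \<Gamma>,
       parcs = {(g, h). g \<in> carrier \<Gamma> \<and> h \<in> carrier \<Gamma> \<and> (\<exists>x\<in>X. g \<otimes>\<^bsub>\<Gamma>\<^esub> x = h)} \<rparr>"

text \<open>
  Every finite group is isomorphic to one whose carrier is a set of natural numbers, so over
  \<^typ>\<open>nat\<close> this predicate describes all Cayley graphs up to isomorphism.
\<close>

definition is_cayley_graph :: "'a pair_pre_digraph \<Rightarrow> bool" where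
  "is_cayley_graph G \<longleftrightarrow>
     (\<exists>(\<Gamma> :: 'a monoid) X.
        group \<Gamma> \<and> finite (carrier \<Gamma>) \<and> connection_set \<Gamma> X \<and> G = cayley_graph \<Gamma> X)"

text \<open>In a symmetric digraph without parallel arcs the out-degree counts the neighbours of a vertex.\<close>

definition regular_graph :: "'a pair_pre_digraph \<Rightarrow> nat \<Rightarrow> bool" where
  "regular_graph G r \<longleftrightarrow> (\<forall>v\<in>pverts G. out_degree (with_proj G) v = r)"

definition proper_colouring :: "'a pair_pre_digraph \<Rightarrow> nat \<Rightarrow> ('a \<Rightarrow> nat) \<Rightarrow> bool" where
  "proper_colouring G k c \<longleftrightarrow>
     (\<forall>v\<in>pverts G. c v < k) \<and> (\<forall>(u, v)\<in>parcs G. c u \<noteq> c v)"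

definition colourable :: "'a pair_pre_digraph \<Rightarrow> nat \<Rightarrow> bool" where
  "colourable G k \<longleftrightarrow> (\<exists>c. proper_colouring G k c)"

definition chromatic_number :: "'a pair_pre_digraph \<Rightarrow> nat" where
  "chromatic_number G = (LEAST k. colourable G k)"

lemma pair_graph_cayley_graph:
  assumes "group \<Gamma>" "finite (carrier \<Gamma>)" "connection_set \<Gamma> X"
  shows "pair_graph (cayley_graph \<Gamma> X)"
proof -
  interpret group \<Gamma> by fact
  have X: "X \<subseteq> carrier \<Gamma>" and inv: "m_inv \<Gamma> ` X = X" and one: "\<one>\<^bsub>\<Gamma>\<^esub> \<notin> X"
    using assms(3) by (auto simp: connection_set_def)
  let ?G = "cayley_graph \<Gamma> X"
  have pverts: "pverts ?G = carrier \<Gamma>"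
    by (simp add: cayley_graph_def)
  have ends: "g \<in> carrier \<Gamma> \<and> h \<in> carrier \<Gamma>" if "(g, h) \<in> parcs ?G" for g h
    using that by (simp add: cayley_graph_def)
  have fin: "finite (parcs ?G)"
    by (rule finite_subset[of _ "carrier \<Gamma> \<times> carrier \<Gamma>"])
       (auto simp: cayley_graph_def assms(2))
  have loop: "(g, g) \<notin> parcs ?G" for g
    using X one by (auto simp: cayley_graph_def)
  have sym: "(h, g) \<in> parcs ?G" if "(g, h) \<in> parcs ?G" for g h
  proof -
    obtain x where x: "g \<in> carrier \<Gamma>" "h \<in> carrier \<Gamma>" "x \<in> X" "g \<otimes>\<^bsub>\<Gamma>\<^esub> x = h"
      using \<open>(g, h) \<in> parcs ?G\<close> by (auto simp: cayley_graph_def)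
    have "inv\<^bsub>\<Gamma>\<^esub> x \<in> X" using x(3) inv by blast
    moreover have "h \<otimes>\<^bsub>\<Gamma>\<^esub> inv\<^bsub>\<Gamma>\<^esub> x = g"
      using x X by (auto simp: m_assoc subset_iff)
    ultimately show ?thesis using x by (auto simp: cayley_graph_def)
  qed
  have "symmetric (with_proj ?G)"
    unfolding symmetric_def with_proj_simps by (rule symI) (rule sym)
  then show ?thesis
    using fin loop ends assms(2) by unfold_locales (auto simp: pverts)
qed

lemma colourable_chromatic_number:
  assumes "pair_graph G"
  shows "colourable G (chromatic_number G)"
proof -
  interpret pair_graph G by fact
  obtain c where c: "bij_betw c (pverts G) {0..<card (pverts G)}"
    using ex_bij_betw_finite_nat[OF pair_finite_verts] by blast
  have "c u \<noteq> c v" if "(u, v) \<in> parcs G" for u v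
    using that c no_loops'[OF that] in_arcsD1[OF that] in_arcsD2[OF that]
    by (auto simp: bij_betw_def inj_on_def)
  then have "proper_colouring G (card (pverts G)) c"
    using c by (auto simp: proper_colouring_def bij_betw_def)
  then show ?thesis
    unfolding chromatic_number_def by (intro LeastI[of "colourable G"]) (auto simp: colourable_def)
qed

end

(*
  Put m = r + 1 - \<chi>. The Cartesian product of the complete graph on \<chi> vertices with the complete
  bipartite graph with parts of size m is a Cayley graph of the product of the cyclic groups of
  orders \<chi> and 2 m: connect along the nonzero elements of the first factor and the odd elements
  of the second. It has degree (\<chi> - 1) + m = r and contains a clique on \<chi> vertices, and
  (a, b) \<mapsto> (a + b mod 2) mod \<chi> is a proper colouring. For m = 0 the second factor is trivial.
*)

theory Submission
  imports Defs
begin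

text \<open>The pair \<open>(a, b)\<close> with \<open>a < k\<close> and \<open>b < n\<close> is encoded by the number \<open>a + k * b\<close>.\<close>

definition cyclic_product :: "nat \<Rightarrow> nat \<Rightarrow> nat monoid" where
  "cyclic_product k n =
     \<lparr> carrier = {..<k * n},
       monoid.mult = (\<lambda>g h. (g + h) mod k + k * ((g div k + h div k) mod n)),
       one = 0 \<rparr>"

text \<open>Numbers in \<open>{0<..<k}\<close> encode the pairs (a, 0) with a nonzero, and
  \<open>k * b\<close> encodes (0, b). For n = 1 there is no odd \<open>b < n\<close>, so only the
  clique part remains.\<close>

definition clique_odd_set :: "nat \<Rightarrow> nat \<Rightarrow> nat set" where
  "clique_odd_set k n = {0<..<k} \<union> (\<lambda>b. k * b) ` {b. b < n \<and> odd b}"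

section \<open>The product of two cyclic groups on encoded pairs\<close>

lemma encode_less:
  fixes a b k n :: nat
  assumes "a < k" "b < n"
  shows "a + k * b < k * n"
proof -
  have "a + k * b < k * Suc b" using assms(1) by simp
  also have "\<dots> \<le> k * n" using assms(2) by (intro mult_le_mono2) simp
  finally show ?thesis .
qed

lemma cyclic_product_simps:
  "carrier (cyclic_product k n) = {..<k * n}"
  "g \<otimes>\<^bsub>cyclic_product k n\<^esub> h = (g + h) mod k + k * ((g div k + h div k) mod n)"
  "\<one>\<^bsub>cyclic_product k n\<^esub> = 0"
  by (simp_all add: cyclic_product_def)

lemma nat_less_multD:
  fixes g k n :: nat
  assumes "g < k * n"
  shows "0 < k" "0 < n" "g div k < n"
  using assms by (auto intro: gr0I simp: less_mult_imp_div_less mult.commute)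

text \<open>Multiples of \<open>k\<close> vanish modulo \<open>k\<close>, so whole codes may be
  added where first coordinates are meant.\<close>

lemma cyclic_product_mult_mod: "(g \<otimes>\<^bsub>cyclic_product k n\<^esub> h) mod k = (g + h) mod k"
  by (simp add: cyclic_product_simps)

lemma cyclic_product_mult_div:
  "0 < k \<Longrightarrow> (g \<otimes>\<^bsub>cyclic_product k n\<^esub> h) div k = (g div k + h div k) mod n"
  by (simp add: cyclic_product_simps)

text \<open>The two coordinates determine the code, so associativity can be checked one coordinate
  at a time.\<close>

lemma mod_div_eqI:
  fixes g h k :: nat
  assumes "g mod k = h mod k" "g div k = h div k"
  shows "g = h"
  using assms by (metis mod_mult_div_eq)

lemma comm_group_cyclic_product:
  assumes "0 < k" "0 < n"
  shows "comm_group (cyclic_product k n)" (is "comm_group ?G")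
proof (rule comm_groupI)
  fix g h assume "g \<in> carrier ?G" "h \<in> carrier ?G"
  show "g \<otimes>\<^bsub>?G\<^esub> h \<in> carrier ?G"
    using assms by (simp add: cyclic_product_simps encode_less)
next
  show "\<one>\<^bsub>?G\<^esub> \<in> carrier ?G"
    using assms by (simp add: cyclic_product_simps)
next
  fix f g h
  have "(f \<otimes>\<^bsub>?G\<^esub> g + h) mod k = (f + g \<otimes>\<^bsub>?G\<^esub> h) mod k"
    by (metis add.assoc cyclic_product_mult_mod mod_add_left_eq mod_add_right_eq)
  then show "f \<otimes>\<^bsub>?G\<^esub> g \<otimes>\<^bsub>?G\<^esub> h = f \<otimes>\<^bsub>?G\<^esub> (g \<otimes>\<^bsub>?G\<^esub> h)"
    using assms by - (rule mod_div_eqI[of _ k], simp_all only: cyclic_product_mult_mod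
        cyclic_product_mult_div mod_add_left_eq mod_add_right_eq add.assoc)
next
  fix g h show "g \<otimes>\<^bsub>?G\<^esub> h = h \<otimes>\<^bsub>?G\<^esub> g"
    by (simp add: cyclic_product_simps add.commute)
next
  fix g assume "g \<in> carrier ?G"
  then show "\<one>\<^bsub>?G\<^esub> \<otimes>\<^bsub>?G\<^esub> g = g"
    by (simp add: cyclic_product_simps nat_less_multD)
next
  fix g assume "g \<in> carrier ?G"
  then have g: "g div k < n" by (simp add: cyclic_product_simps nat_less_multD)
  \<comment> \<open>Coordinatewise negatives; the outer \<open>mod\<close> sends
    \<open>k - 0\<close> and \<open>n - 0\<close> back to 0, which keeps both in range.\<close>
  define a b where "a = (k - g mod k) mod k" and "b = (n - g div k) mod n"
  have ab: "a < k" "b < n" using assms by (auto simp: a_def b_def)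
  have "(a + g) mod k = (k - g mod k + g mod k) mod k"
    unfolding a_def by (simp only: mod_add_left_eq mod_add_right_eq)
  moreover have "(b + g div k) mod n = (n - g div k + g div k) mod n"
    unfolding b_def by (simp only: mod_add_left_eq)
  ultimately have 0: "(a + g) mod k = 0" "(b + g div k) mod n = 0"
    using assms g by simp_all
  have "(a + k * b + g) mod k = 0"
    using 0(1) by (metis add.assoc add.commute mod_mult_self2)
  then have "(a + k * b) \<otimes>\<^bsub>?G\<^esub> g = \<one>\<^bsub>?G\<^esub>"
    using 0(2) ab assms by (simp add: cyclic_product_simps)
  then show "\<exists>h\<in>carrier ?G. h \<otimes>\<^bsub>?G\<^esub> g = \<one>\<^bsub>?G\<^esub>"
    using encode_less[OF ab] by (auto simp: cyclic_product_simps(1))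
qed

lemma group_cyclic_product: "0 < k \<Longrightarrow> 0 < n \<Longrightarrow> group (cyclic_product k n)"
  by (simp add: comm_group.axioms(2) comm_group_cyclic_product)

section \<open>The connection set\<close>

lemma clique_odd_set_subset:
  assumes "0 < k" "0 < n"
  shows "clique_odd_set k n \<subseteq> carrier (cyclic_product k n)"
  using assms encode_less[of _ k 0 n] encode_less[of 0 k _ n]
  by (auto simp: clique_odd_set_def cyclic_product_simps)

lemma card_clique_odd_set:
  assumes "0 < k"
  shows "card (clique_odd_set k n) = k - 1 + n div 2"
proof -
  have "{b. b < n \<and> odd b} = (\<lambda>i. 2 * i + 1) ` {..<n div 2}"
    by (auto elim!: oddE)
  then have "card {b. b < n \<and> odd b} = n div 2"
    by (simp add: card_image inj_on_def)
  then have "card ((\<lambda>b. k * b) ` {b. b < n \<and> odd b}) = n div 2"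
    using assms by (simp add: card_image inj_on_def)
  then show ?thesis
    \<comment> \<open>The union is disjoint: an odd \<open>b\<close> is at least 1, so
      \<open>k * b\<close> is at least \<open>k\<close>.\<close>
    unfolding clique_odd_set_def by (subst card_Un_disjoint) auto
qed

lemma generate_clique_odd_set:
  assumes "0 < k" and n: "n = 1 \<or> even n" "0 < n"
  shows "generate (cyclic_product k n) (clique_odd_set k n) = carrier (cyclic_product k n)"
    (is "generate ?G ?X = _")
proof
  interpret group ?G using assms by (intro group_cyclic_product)
  show "generate ?G ?X \<subseteq> carrier ?G"
    using assms by (intro generate_incl clique_odd_set_subset)
  have zero: "0 \<in> generate ?G ?X"
    using generate.one[of ?G ?X] by (simp add: cyclic_product_simps)
  have clique: "a \<in> generate ?G ?X" if "a < k" for a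
    using that zero by (cases "a = 0") (auto intro!: generate.incl simp: clique_odd_set_def)
  have odd: "k * b \<in> generate ?G ?X" if "b < n" "odd b" for b
    using that by (auto intro!: generate.incl simp: clique_odd_set_def)
  have second: "k * b \<in> generate ?G ?X" if "b < n" for b
  proof (cases "odd b \<or> b = 0")
    case False
    \<comment> \<open>A nonzero even \<open>b\<close> is the sum of the odd numbers 1 and
      \<open>b - 1\<close>.\<close>
    then have "k * 1 \<otimes>\<^bsub>?G\<^esub> (k * (b - 1)) \<in> generate ?G ?X"
      using that by (intro generate.eng odd) auto
    then show ?thesis using that False assms(1) by (simp add: cyclic_product_simps)
  qed (use odd zero that in auto)
  show "carrier ?G \<subseteq> generate ?G ?X"
  proof
    fix g assume "g \<in> carrier ?G"
    then have g: "g div k < n" by (simp add: cyclic_product_simps nat_less_multD)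
    \<comment> \<open>Each pair (a, b) is the product of (a, 0) and (0, b).\<close>
    have "g mod k \<otimes>\<^bsub>?G\<^esub> (k * (g div k)) \<in> generate ?G ?X"
      using g assms(1) by (intro generate.eng second clique) auto
    then show "g \<in> generate ?G ?X" using g assms(1) by (simp add: cyclic_product_simps)
  qed
qed

text \<open>The inverse of \<open>x\<close> in \<open>{0<..<k}\<close> is \<open>k - x\<close>, and
  that of \<open>k * b\<close> is \<open>k * (n - b)\<close>. For even \<open>n\<close> the number
  \<open>n - b\<close> is again odd; for n = 1 the second case is void.\<close>

lemma inv_clique_odd_set:
  assumes "0 < k" and n: "n = 1 \<or> even n" "0 < n"
  shows "m_inv (cyclic_product k n) ` clique_odd_set k n = clique_odd_set k n"
    (is "m_inv ?G ` ?X = _")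
proof -
  interpret comm_group ?G using assms by (intro comm_group_cyclic_product)
  have X: "?X \<subseteq> carrier ?G" using assms by (intro clique_odd_set_subset)
  have "\<exists>y\<in>?X. x \<otimes>\<^bsub>?G\<^esub> y = \<one>\<^bsub>?G\<^esub>" if "x \<in> ?X" for x
    using that unfolding clique_odd_set_def
  proof (elim UnE imageE)
    assume "x \<in> {0<..<k}"
    then show "\<exists>y\<in>{0<..<k} \<union> (\<lambda>b. k * b) ` {b. b < n \<and> odd b}. x \<otimes>\<^bsub>?G\<^esub> y = \<one>\<^bsub>?G\<^esub>"
      by (intro bexI[of _ "k - x"]) (auto simp: cyclic_product_simps)
  next
    fix b assume "x = k * b" "b \<in> {b. b < n \<and> odd b}"
    then show "\<exists>y\<in>{0<..<k} \<union> (\<lambda>b. k * b) ` {b. b < n \<and> odd b}. x \<otimes>\<^bsub>?G\<^esub> y = \<one>\<^bsub>?G\<^esub>"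
      using n assms(1) odd_pos[of b]
      by (intro bexI[of _ "k * (n - b)"]) (auto simp: cyclic_product_simps)
  qed
  then have sub: "inv\<^bsub>?G\<^esub> x \<in> ?X" if "x \<in> ?X" for x
    using that X inv_equality m_comm by (metis subsetD)
  \<comment> \<open>Inversion is an involution, so closure under it already gives equality.\<close>
  then show ?thesis
    using X by (force intro: image_eqI[of _ _ "inv\<^bsub>?G\<^esub> _"])
qed

lemma connection_set_clique_odd_set:
  assumes "0 < k" "n = 1 \<or> even n" "0 < n"
  shows "connection_set (cyclic_product k n) (clique_odd_set k n)"
proof -
  have "\<one>\<^bsub>cyclic_product k n\<^esub> \<notin> clique_odd_set k n"
    using assms(1) by (auto simp: clique_odd_set_def cyclic_product_simps)
  then show ?thesis
    using assms by (simp add: connection_set_def clique_odd_set_subset generate_clique_odd_set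
        inv_clique_odd_set)
qed

section \<open>Degree\<close>

lemma regular_cayley_graph:
  assumes "group \<Gamma>" "X \<subseteq> carrier \<Gamma>"
  shows "regular_graph (cayley_graph \<Gamma> X) (card X)"
  unfolding regular_graph_def
proof
  interpret group \<Gamma> by fact
  fix v assume "v \<in> pverts (cayley_graph \<Gamma> X)"
  then have v: "v \<in> carrier \<Gamma>" by (simp add: cayley_graph_def)
  have "out_arcs (with_proj (cayley_graph \<Gamma> X)) v = (\<lambda>x. (v, v \<otimes>\<^bsub>\<Gamma>\<^esub> x)) ` X"
    using v assms(2) by (auto simp: out_arcs_def cayley_graph_def)
  \<comment> \<open>Left cancellation makes the neighbours of \<open>v\<close> distinct for distinct
    elements of \<open>X\<close>.\<close>
  moreover have "inj_on (\<lambda>x. (v, v \<otimes>\<^bsub>\<Gamma>\<^esub> x)) X"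
    using v assms(2) by (auto simp: inj_on_def subset_iff)
  ultimately show "out_degree (with_proj (cayley_graph \<Gamma> X)) v = card X"
    by (simp add: out_degree_def card_image)
qed

section \<open>Chromatic number\<close>

lemma clique_le_colours:
  assumes "proper_colouring G j c" "K \<subseteq> pverts G"
    and "\<And>u v. u \<in> K \<Longrightarrow> v \<in> K \<Longrightarrow> u \<noteq> v \<Longrightarrow> (u, v) \<in> parcs G"
  shows "card K \<le> j"
proof -
  have "inj_on c K" using assms unfolding inj_on_def proper_colouring_def by blast
  moreover have "c ` K \<subseteq> {..<j}" using assms unfolding proper_colouring_def by auto
  ultimately show ?thesis using card_inj_on_le[of c K "{..<j}"] by simp
qed

text \<open>Otherwise \<open>k\<close> would divide \<open>x\<close>. This separates the colours at
  the ends of an arc, which differ by a nonzero residue.\<close>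

lemma add_mod_neq:
  fixes s x k :: nat
  assumes "0 < x" "x < k"
  shows "(s + x) mod k \<noteq> s mod k"
proof
  assume "(s + x) mod k = s mod k"
  then have "k dvd s + x - s" using mod_eq_dvd_iff_nat[of s "s + x" k] by simp
  then show False using assms by (simp add: nat_dvd_not_less)
qed

text \<open>A clique element \<open>x\<close> shifts the colour by \<open>x\<close> modulo
  \<open>k\<close>. An odd element keeps the first coordinate and flips the parity of the second,
  which changes the colour by 1 up to sign.\<close>

lemma proper_colouring_clique_odd:
  assumes "2 \<le> k" "n = 1 \<or> even n" "0 < n"
  shows "proper_colouring (cayley_graph (cyclic_product k n) (clique_odd_set k n)) k
           (\<lambda>g. (g + g div k mod 2) mod k)"
    (is "proper_colouring _ _ ?c")
proof -
  have "?c g \<noteq> ?c (g \<otimes>\<^bsub>cyclic_product k n\<^esub> x)"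
    if "g < k * n" "x \<in> clique_odd_set k n" for g x
    using that(2) unfolding clique_odd_set_def
  proof (elim UnE imageE)
    assume x: "x \<in> {0<..<k}"
    then have "?c (g \<otimes>\<^bsub>cyclic_product k n\<^esub> x) = ((g + g div k mod 2) + x) mod k"
      using nat_less_multD[OF that(1)] by (simp add: cyclic_product_simps mod_simps add_ac)
    then show ?thesis using x add_mod_neq[of x k "g + g div k mod 2"] by simp
  next
    fix b assume b: "x = k * b" "b \<in> {b. b < n \<and> odd b}"
    have shift: "(g + (k * s + u)) mod k = (g + u) mod k" for s u
      by (simp add: add.left_commute[of g])
    \<comment> \<open>An odd \<open>b < n\<close> rules out n = 1. As \<open>n\<close> is even,
      reduction modulo \<open>n\<close> preserves parity.\<close>
    have "even n" using b assms odd_pos[of b] by auto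
    then have "(g div k + b) mod n mod 2 = (g div k + b) mod 2"
      by (simp add: mod_mod_cancel)
    then have "?c (g \<otimes>\<^bsub>cyclic_product k n\<^esub> x) = (g + (g div k + b) mod 2) mod k"
      using b assms(1) by (simp add: cyclic_product_simps mod_simps add.assoc shift)
    \<comment> \<open>After the flip the two colours are, in some order, the residues of
      \<open>g\<close> and \<open>g + 1\<close>.\<close>
    moreover have "(g div k + b) mod 2 = 1 - g div k mod 2"
      using b by (auto simp: mod2_eq_if)
    ultimately show ?thesis
      using assms(1) add_mod_neq[of 1 k g] by (cases "even (g div k)") (auto simp: mod2_eq_if)
  qed
  then show ?thesis
    using assms(1) by (auto simp: proper_colouring_def cayley_graph_def cyclic_product_simps(1))
qed

text \<open>The explicit colouring bounds the number from above; the clique \<open>{..<k}\<close>,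
  the pairs with second coordinate 0, bounds it from below.\<close>

lemma chromatic_number_clique_odd:
  assumes "2 \<le> k" "n = 1 \<or> even n" "0 < n"
  shows "chromatic_number (cayley_graph (cyclic_product k n) (clique_odd_set k n)) = k"
    (is "chromatic_number ?C = k")
  unfolding chromatic_number_def
proof (rule Least_equality)
  show "colourable ?C k"
    using proper_colouring_clique_odd[OF assms] by (auto simp: colourable_def)
next
  fix j assume "colourable ?C j"
  then obtain c where c: "proper_colouring ?C j c" by (auto simp: colourable_def)
  have k: "u < k * n" if "u < k" for u
    using that encode_less[of u k 0 n] assms(3) by simp
  have "(u, v) \<in> parcs ?C" if "u < k" "v < k" "u \<noteq> v" for u v
  proof -
    \<comment> \<open>The difference \<open>v - u\<close> modulo \<open>k\<close>, represented in
      \<open>{0<..<k}\<close>.\<close>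
    define x where "x = (if u < v then v - u else k + v - u)"
    have "x \<in> clique_odd_set k n" "u \<otimes>\<^bsub>cyclic_product k n\<^esub> x = v"
      using that by (auto simp: x_def clique_odd_set_def cyclic_product_simps)
    then show ?thesis
      using that k by (auto simp: cayley_graph_def cyclic_product_simps(1))
  qed
  then have "card {..<k} \<le> j"
    using k assms(3) by (intro clique_le_colours[OF c]) (auto simp: cayley_graph_def cyclic_product_simps(1))
  then show "k \<le> j" by simp
qed

theorem theorem1:
  fixes r \<chi> :: nat
  assumes "2 \<le> \<chi>" and "\<chi> \<le> r + 1"
  shows "\<exists>G :: nat pair_pre_digraph.
           is_cayley_graph G \<and> regular_graph G r \<and> chromatic_number G = \<chi>"
proof -
  \<comment> \<open>The order 2 m of the second factor, chosen so that \<open>n div 2\<close>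
    supplies the missing degree \<open>r + 1 - \<chi>\<close>. At m = 0 it must be 1, since order 0
    would leave an empty carrier.\<close>
  define n where "n = (if \<chi> = r + 1 then 1 else 2 * (r + 1 - \<chi>))"
  have n: "n = 1 \<or> even n" "0 < n" using assms by (auto simp: n_def)
  let ?\<Gamma> = "cyclic_product \<chi> n" and ?X = "clique_odd_set \<chi> n"
  have \<Gamma>: "group ?\<Gamma>" using group_cyclic_product n assms by simp
  have X: "connection_set ?\<Gamma> ?X" using connection_set_clique_odd_set n assms by simp
  have "card ?X = r" using assms by (simp add: card_clique_odd_set n_def)
  then have "regular_graph (cayley_graph ?\<Gamma> ?X) r"
    using regular_cayley_graph[OF \<Gamma>] X by (auto simp: connection_set_def)
  moreover have "is_cayley_graph (cayley_graph ?\<Gamma> ?X)"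
    using \<Gamma> X unfolding is_cayley_graph_def
    by (intro exI[of _ ?\<Gamma>] exI[of _ ?X]) (simp add: cyclic_product_simps)
  ultimately show ?thesis
    using chromatic_number_clique_odd[OF assms(1) n] by blast
qed

end
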